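(* Let $\mathcal{A}$ be a union-closed family containing $\emptyset$. If $P^{\mathcal{A}}$ is nonempty, then there is some $c\in P^{\mathcal{A}}$ such that $c_i=c_j$ for all $i,j\in U(\mathcal{A})$ for which there is an automorphism of $\mathcal{A}$ that maps $i$ to $j$.
   Context: All families are finite families of finite sets. A family $\mathcal{F}$ is union-closed if $A\cup B\in\mathcal{F}$ for all $A,B\in\mathcal{F}$. For a family $\mathcal{F}$, $U(\mathcal{F})=\bigcup_{S\in\mathcal{F}}S$ is its ground set and $\mathcal{F}_i=\{S\in\mathcal{F}: i\in S\}$. For families $\mathcal{A},\mathcal{B}$, $\mathcal{A}\uplus\mathcal{B}=\{A\cup B: A\in\mathcal{A}, B\in\mathcal{B}\}$. An automorphism of $\mathcal{A}$ is a bijection $\phi:U(\mathcal{A})\to U(\mathcal{A})$ such that $\mathcal{A}=\{\phi(S):S\in\mathcal{A}\}$. For a union-closed family $\mathcal{A}$ containing $\emptyset$, let $\mathbb{B}(\mathcal{A})$ be the set of all union-closed $\mathcal{B}\subseteq\mathcal{P}(U(\mathcal{A}))$ (power set of $U(\mathcal{A})$) with $\mathcal{A}\uplus\mathcal{B}=\mathcal{B}$, and let $P^{\mathcal{A}}$ be the set of all vectors $c=(c_i)_{i\in U(\mathcal{A})}$ of nonnegative real numbers with $\sum_{i\in U(\mathcal{A})}c_i=1$ and $\sum_{i\in U(\mathcal{A})}c_i|\mathcal{B}_i|\ge|\mathcal{B}|/2$ for all $\mathcal{B}\in\mathbb{B}(\mathcal{A})$. *)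

theory Defs
  imports Complex_Main "HOL-Library.FuncSet"
begin

definition finite_family :: "'a set set \<Rightarrow> bool" where
  "finite_family \<F> \<longleftrightarrow> finite \<F> \<and> (\<forall>S\<in>\<F>. finite S)"

definition union_closed :: "'a set set \<Rightarrow> bool" where
  "union_closed \<F> \<longleftrightarrow> (\<forall>A\<in>\<F>. \<forall>B\<in>\<F>. A \<union> B \<in> \<F>)"

abbreviation ground_set :: "'a set set \<Rightarrow> 'a set" where
  "ground_set \<F> \<equiv> \<Union>\<F>"

definition members_at :: "'a set set \<Rightarrow> 'a \<Rightarrow> 'a set set" where
  "members_at \<F> i = {S \<in> \<F>. i \<in> S}"

definition family_join :: "'a set set \<Rightarrow> 'a set set \<Rightarrow> 'a set set" where
  "family_join \<A> \<B> = {A \<union> B | A B. A \<in> \<A> \<and> B \<in> \<B>}"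

text \<open>Only the values of \<open>\<phi>\<close> on the ground set matter.\<close>

definition family_automorphism :: "'a set set \<Rightarrow> ('a \<Rightarrow> 'a) \<Rightarrow> bool" where
  "family_automorphism \<A> \<phi> \<longleftrightarrow>
     bij_betw \<phi> (ground_set \<A>) (ground_set \<A>) \<and> \<A> = {\<phi> ` S | S. S \<in> \<A>}"

text \<open>The empty family belongs to \<open>invariant_families \<A>\<close>; the inequality it
  contributes to \<open>weight_polytope\<close> below reads \<open>0 \<ge> 0\<close>.\<close>

definition invariant_families :: "'a set set \<Rightarrow> 'a set set set" where
  "invariant_families \<A> =
     {\<B>. \<B> \<subseteq> Pow (ground_set \<A>) \<and> union_closed \<B> \<and> family_join \<A> \<B> = \<B>}"

text \<open>A vector indexed by the ground set is an extensional function on it.\<close>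

definition weight_polytope :: "'a set set \<Rightarrow> ('a \<Rightarrow> real) set" where
  "weight_polytope \<A> =
     {c \<in> ground_set \<A> \<rightarrow>\<^sub>E {0..}.
        (\<Sum>i\<in>ground_set \<A>. c i) = 1 \<and>
        (\<forall>\<B>\<in>invariant_families \<A>.
           (\<Sum>i\<in>ground_set \<A>. c i * real (card (members_at \<B> i))) \<ge> real (card \<B>) / 2)}"

end

theory Submission
  imports Defs
begin

text \<open>The polytope \<open>weight_polytope \<A>\<close> is convex, and an automorphism \<open>\<phi>\<close> of \<open>\<A>\<close> permutes
  \<open>invariant_families \<A>\<close>, so \<open>c \<circ> \<phi>\<close> lies in the polytope whenever \<open>c\<close> does. Averaging a point of
  the polytope over the finite automorphism group gives a point that is constant on orbits.\<close>

lemma union_closed_image: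
  assumes "union_closed \<B>"
  shows "union_closed ((`) \<phi> ` \<B>)"
  using assms unfolding union_closed_def ball_simps image_Un[symmetric] by blast

lemma family_join_image:
  "family_join ((`) \<phi> ` \<A>) ((`) \<phi> ` \<B>) = (`) \<phi> ` family_join \<A> \<B>" (is "?L = ?R")
proof -
  have "?L = {\<phi> ` A \<union> \<phi> ` B | A B. A \<in> \<A> \<and> B \<in> \<B>}" by (auto simp only: family_join_def)
  also have "\<dots> = {\<phi> ` (A \<union> B) | A B. A \<in> \<A> \<and> B \<in> \<B>}" by (simp only: image_Un)
  also have "\<dots> = ?R" unfolding family_join_def by blast
  finally show ?thesis .
qed

text \<open>Writing the condition as an image equation lets it rewrite the left-hand sides produced
  by \<open>family_join_image\<close>.\<close>

lemma family_automorphism_iff: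
  "family_automorphism \<A> \<phi> \<longleftrightarrow>
     bij_betw \<phi> (ground_set \<A>) (ground_set \<A>) \<and> (`) \<phi> ` \<A> = \<A>"
  unfolding family_automorphism_def Setcompr_eq_image by (simp only: eq_commute)

text \<open>This allows an automorphism to be exchanged for its extensional restriction to the
  ground set, the normal form used for the group in the main proof.\<close>

lemma family_automorphism_cong:
  assumes "\<And>i. i \<in> ground_set \<A> \<Longrightarrow> \<phi> i = \<psi> i"
  shows "family_automorphism \<A> \<phi> \<longleftrightarrow> family_automorphism \<A> \<psi>"
proof -
  have "\<phi> ` S = \<psi> ` S" if "S \<in> \<A>" for S
    using that assms by (intro image_cong) auto
  then have "(`) \<phi> ` \<A> = (`) \<psi> ` \<A>" by (rule image_cong[OF refl])
  moreover have "bij_betw \<phi> (ground_set \<A>) (ground_set \<A>) \<longleftrightarrow>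
      bij_betw \<psi> (ground_set \<A>) (ground_set \<A>)"
    using assms by (rule bij_betw_cong)
  ultimately show ?thesis by (simp add: family_automorphism_iff)
qed

lemma family_automorphism_comp:
  assumes "family_automorphism \<A> \<phi>" "family_automorphism \<A> \<psi>"
  shows "family_automorphism \<A> (\<phi> \<circ> \<psi>)"
proof -
  have "(`) (\<phi> \<circ> \<psi>) ` \<A> = (`) \<phi> ` (`) \<psi> ` \<A>" by (simp only: image_image comp_def)
  then show ?thesis
    using assms bij_betw_trans[of \<psi> "ground_set \<A>" "ground_set \<A>" \<phi> "ground_set \<A>"]
    by (simp add: family_automorphism_iff)
qed

text \<open>Taking images commutes with unions, hence with joins, so \<open>\<A>\<close> joined with
  the image of \<open>\<B>\<close> is the image of \<open>\<B>\<close> as soon as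
  \<open>\<phi>\<close> maps \<open>\<A>\<close> onto itself.\<close>

lemma invariant_families_image:
  assumes "family_automorphism \<A> \<phi>" "\<B> \<in> invariant_families \<A>"
  shows "(`) \<phi> ` \<B> \<in> invariant_families \<A>"
proof -
  have "family_join \<A> ((`) \<phi> ` \<B>) = (`) \<phi> ` \<B>"
    using assms family_join_image[of \<phi> \<A> \<B>]
    by (simp add: family_automorphism_iff invariant_families_def)
  moreover have "(`) \<phi> ` \<B> \<subseteq> Pow (ground_set \<A>)"
  proof (rule image_subsetI)
    fix S assume "S \<in> \<B>"
    then have "\<phi> ` S \<subseteq> \<phi> ` ground_set \<A>"
      using assms(2) by (intro image_mono) (auto simp: invariant_families_def)
    then show "\<phi> ` S \<in> Pow (ground_set \<A>)"
      using assms(1) by (simp add: family_automorphism_iff bij_betw_def)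
  qed
  ultimately show ?thesis
    using assms by (simp add: invariant_families_def union_closed_image)
qed

text \<open>Injectivity on \<open>X\<close> enters twice: \<open>\<phi> i\<close> lies in the image
  of \<open>S\<close> only if \<open>i\<close> lies in \<open>S\<close>, and distinct subsets of
  \<open>X\<close> keep distinct images.\<close>

lemma card_members_at_image:
  assumes "inj_on \<phi> X" "\<B> \<subseteq> Pow X" "i \<in> X"
  shows "card (members_at ((`) \<phi> ` \<B>) (\<phi> i)) = card (members_at \<B> i)"
proof -
  have "\<phi> i \<in> \<phi> ` S \<longleftrightarrow> i \<in> S" if "S \<in> \<B>" for S
    using inj_on_image_mem_iff[OF assms(1,3)] assms(2) that by blast
  then have "members_at ((`) \<phi> ` \<B>) (\<phi> i) = (`) \<phi> ` members_at \<B> i"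
    by (auto simp: members_at_def)
  moreover have "inj_on ((`) \<phi>) (members_at \<B> i)"
    using assms(2) by (intro inj_on_subset[OF inj_on_image_Pow[OF assms(1)]]) (auto simp: members_at_def)
  ultimately show ?thesis by (simp add: card_image)
qed

text \<open>Both vectors shown below to lie in the polytope are built as restrictions; this settles
  extensionality once and leaves only the linear conditions.\<close>

lemma restrict_weight_polytope_iff:
  "restrict c (ground_set \<A>) \<in> weight_polytope \<A> \<longleftrightarrow>
     (\<forall>i\<in>ground_set \<A>. c i \<ge> 0) \<and> (\<Sum>i\<in>ground_set \<A>. c i) = 1 \<and>
     (\<forall>\<B>\<in>invariant_families \<A>.
        (\<Sum>i\<in>ground_set \<A>. c i * real (card (members_at \<B> i))) \<ge> real (card \<B>) / 2)"
proof -
  have "(\<Sum>i\<in>ground_set \<A>. restrict c (ground_set \<A>) i * w i) = (\<Sum>i\<in>ground_set \<A>. c i * w i)" for w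
    by (intro sum.cong refl) (simp only: restrict_apply')
  \<comment> \<open>The constant weight 1 turns the identity into the one for the normalising
    sum.\<close>
  from this this[of "\<lambda>_. 1"] show ?thesis
    unfolding weight_polytope_def mem_Collect_eq restrict_PiE_iff by (simp only: atLeast_iff mult_1_right)
qed

text \<open>Reindexing the sum along \<open>\<phi>\<close> shows that the inequality for
  \<open>c \<circ> \<phi>\<close> at \<open>\<B>\<close> is the inequality for \<open>c\<close> at
  the image of \<open>\<B>\<close>, which is again an invariant family.\<close>

lemma weight_polytope_automorphism:
  assumes "family_automorphism \<A> \<phi>" "c \<in> weight_polytope \<A>"
  shows "restrict (c \<circ> \<phi>) (ground_set \<A>) \<in> weight_polytope \<A>"
proof -
  let ?X = "ground_set \<A>"
  have bij: "bij_betw \<phi> ?X ?X" using assms(1) by (simp add: family_automorphism_iff)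
  have "(\<Sum>i\<in>?X. c (\<phi> i)) = 1"
    using sum.reindex_bij_betw[OF bij, of c] assms(2) by (simp add: weight_polytope_def)
  moreover have "c (\<phi> i) \<ge> 0" if "i \<in> ?X" for i
    using assms(2) bij_betwE[OF bij] that by (auto simp: weight_polytope_def PiE_iff)
  moreover have "(\<Sum>i\<in>?X. c (\<phi> i) * real (card (members_at \<B> i))) \<ge> real (card \<B>) / 2"
    if \<B>: "\<B> \<in> invariant_families \<A>" for \<B>
  proof -
    let ?\<B>' = "(`) \<phi> ` \<B>"
    have sub: "\<B> \<subseteq> Pow ?X" using \<B> by (simp add: invariant_families_def)
    have inj: "inj_on \<phi> ?X" using bij by (rule bij_betw_imp_inj_on)
    have "card \<B> = card ?\<B>'"
      using inj_on_subset[OF inj_on_image_Pow[OF inj] sub] by (simp add: card_image)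
    also have "real (card ?\<B>') / 2 \<le> (\<Sum>j\<in>?X. c j * real (card (members_at ?\<B>' j)))"
      using assms(2) invariant_families_image[OF assms(1) \<B>] by (simp add: weight_polytope_def)
    also have "\<dots> = (\<Sum>i\<in>?X. c (\<phi> i) * real (card (members_at ?\<B>' (\<phi> i))))"
      by (rule sum.reindex_bij_betw[OF bij, symmetric])
    also have "\<dots> = (\<Sum>i\<in>?X. c (\<phi> i) * real (card (members_at \<B> i)))"
      by (intro sum.cong refl) (simp only: card_members_at_image[OF inj sub])
    finally show ?thesis .
  qed
  ultimately show ?thesis unfolding restrict_weight_polytope_iff comp_apply by blast
qed

text \<open>Every defining condition is linear in the vector, so it survives summation over
  \<open>G\<close> and division by \<open>card G\<close>. Indexing by \<open>G\<close> counts
  repeated vectors with multiplicity.\<close>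

lemma weight_polytope_average:
  assumes "finite G" "G \<noteq> {}" "\<And>g. g \<in> G \<Longrightarrow> d g \<in> weight_polytope \<A>"
  shows "(\<lambda>i\<in>ground_set \<A>. (\<Sum>g\<in>G. d g i) / card G) \<in> weight_polytope \<A>"
proof -
  let ?X = "ground_set \<A>"
  have pos: "real (card G) > 0" using assms(1,2) by (simp add: card_gt_0_iff)
  \<comment> \<open>One interchange of sums serves both the normalisation, with \<open>w\<close>
    constantly 1, and the inequalities, with \<open>w\<close> the member counts.\<close>
  have swap: "(\<Sum>i\<in>?X. (\<Sum>g\<in>G. d g i) / card G * w i) = (\<Sum>g\<in>G. \<Sum>i\<in>?X. d g i * w i) / card G"
    for w
    unfolding sum_divide_distrib sum_distrib_right times_divide_eq_left by (rule sum.swap)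
  have "(\<Sum>i\<in>?X. (\<Sum>g\<in>G. d g i) / card G) = 1"
    using swap[of "\<lambda>_. 1"] assms(3) pos by (simp add: weight_polytope_def)
  moreover have "(\<Sum>g\<in>G. d g i) / card G \<ge> 0" if "i \<in> ?X" for i
    using assms(3) that
    by (intro divide_nonneg_nonneg sum_nonneg) (auto simp: weight_polytope_def PiE_iff)
  moreover have "(\<Sum>i\<in>?X. (\<Sum>g\<in>G. d g i) / card G * real (card (members_at \<B> i))) \<ge> real (card \<B>) / 2"
    if "\<B> \<in> invariant_families \<A>" for \<B>
  proof -
    have "(\<Sum>g\<in>G. \<Sum>i\<in>?X. d g i * real (card (members_at \<B> i))) \<ge> of_nat (card G) * (real (card \<B>) / 2)"
      using assms(3) that by (intro sum_bounded_below) (simp add: weight_polytope_def)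
    then show ?thesis
      unfolding swap using pos by (simp add: field_simps)
  qed
  ultimately show ?thesis unfolding restrict_weight_polytope_iff by blast
qed

theorem theorem3p1:
  fixes \<A> :: "'a set set"
  assumes "finite_family \<A>"
    and "union_closed \<A>"
    and "{} \<in> \<A>"
    and "weight_polytope \<A> \<noteq> {}"
  shows "\<exists>c\<in>weight_polytope \<A>.
    \<forall>i\<in>ground_set \<A>. \<forall>j\<in>ground_set \<A>.
      (\<exists>\<phi>. family_automorphism \<A> \<phi> \<and> \<phi> i = j) \<longrightarrow> c i = c j"
proof -
  let ?X = "ground_set \<A>"
  obtain c where c: "c \<in> weight_polytope \<A>" using assms(4) by blast
  \<comment> \<open>Extensional functions give each automorphism a single representative, which
    makes \<open>G\<close> finite.\<close>
  define G where "G = {\<phi> \<in> ?X \<rightarrow>\<^sub>E ?X. family_automorphism \<A> \<phi>}"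
  have "finite ?X" using assms(1) by (auto simp: finite_family_def)
  then have "finite G" unfolding G_def by (simp add: finite_PiE)
  have G_restrict: "restrict \<phi> ?X \<in> G" if "family_automorphism \<A> \<phi>" for \<phi>
  proof -
    have "family_automorphism \<A> (restrict \<phi> ?X)"
      using that family_automorphism_cong[of \<A> "restrict \<phi> ?X" \<phi>] by simp
    moreover have "\<phi> \<in> ?X \<rightarrow> ?X"
      using that by (auto simp: family_automorphism_iff dest: bij_betwE)
    ultimately show ?thesis by (simp add: G_def restrict_PiE_iff Pi_iff)
  qed
  have "family_automorphism \<A> id" by (simp add: family_automorphism_iff)
  then have "G \<noteq> {}" using G_restrict by blast
  define d where "d = (\<lambda>\<phi>. restrict (c \<circ> \<phi>) ?X)"
  define c' where "c' = (\<lambda>i\<in>?X. (\<Sum>\<phi>\<in>G. d \<phi> i) / card G)"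
  have "d \<phi> \<in> weight_polytope \<A>" if "\<phi> \<in> G" for \<phi>
    unfolding d_def using that c by (intro weight_polytope_automorphism) (simp_all only: G_def mem_Collect_eq)
  then have "c' \<in> weight_polytope \<A>"
    unfolding c'_def by (rule weight_polytope_average[OF \<open>finite G\<close> \<open>G \<noteq> {}\<close>])
  moreover have "c' i = c' (\<psi> i)"
    if i: "i \<in> ?X" and \<psi>: "family_automorphism \<A> \<psi>" for i \<psi>
  proof -
    have bij: "bij_betw \<psi> ?X ?X" using \<psi> by (simp add: family_automorphism_iff)
    \<comment> \<open>Right translation by \<open>\<psi>\<close>, restricted so that its values on
      \<open>G\<close> are extensional again.\<close>
    let ?T = "\<lambda>\<phi>. restrict (\<phi> \<circ> \<psi>) ?X"
    have "inj_on ?T G"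
    proof (rule inj_onI)
      fix \<phi> \<phi>' assume \<phi>: "\<phi> \<in> G" "\<phi>' \<in> G" and eq: "?T \<phi> = ?T \<phi>'"
      show "\<phi> = \<phi>'"
      proof (rule PiE_ext)
        show "\<phi> \<in> ?X \<rightarrow>\<^sub>E ?X" "\<phi>' \<in> ?X \<rightarrow>\<^sub>E ?X" using \<phi> by (auto simp: G_def)
        fix x assume "x \<in> ?X"
        \<comment> \<open>Surjectivity of \<open>\<psi>\<close> makes the values of
          \<open>\<phi>\<close> at the points \<open>\<psi> y\<close> determine
          \<open>\<phi>\<close> on the whole ground set.\<close>
        then obtain y where y: "y \<in> ?X" "x = \<psi> y" using bij by (auto simp: bij_betw_def)
        then show "\<phi> x = \<phi>' x" using fun_cong[OF eq, of y] by simp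
      qed
    qed
    moreover have "?T ` G \<subseteq> G"
      using \<psi> by (auto simp: G_def intro!: G_restrict[unfolded G_def] family_automorphism_comp)
    \<comment> \<open>An injective self-map of a finite set is onto; this takes the place of
      composing with the inverse of \<open>\<psi>\<close>.\<close>
    ultimately have "bij_betw ?T G G"
      using \<open>finite G\<close> by (simp add: bij_betw_def endo_inj_surj)
    then have "(\<Sum>\<phi>\<in>G. c (?T \<phi> i)) = (\<Sum>\<phi>\<in>G. c (\<phi> i))"
      by (rule sum.reindex_bij_betw)
    \<comment> \<open>Since \<open>\<psi> i\<close> lies in the ground set, the left sum is the
      numerator of \<open>c' (\<psi> i)\<close> and the right one that of
      \<open>c' i\<close>.\<close>
    then show ?thesis
      using i bij_betw_apply[OF bij i] by (simp add: c'_def d_def del: Union_iff)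
  qed
  ultimately show ?thesis by blast
qed

end
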